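(* If $G$ is a finite group of covariant dimension $1$, then $G$ is cyclic.
   Context: The base field is $\mathbb C$; all $G$-modules are finite-dimensional over $\mathbb C$. A covariant of a finite group $G$ is a $G$-equivariant morphism (polynomial map) $\varphi\colon V\to W$ between $G$-modules; its dimension is $\dim\varphi:=\dim\overline{\varphi(V)}$. It is faithful if $G$ acts faithfully on the image $\varphi(V)$. The covariant dimension $\operatorname{covdim} G$ is the minimum of $\dim\varphi$ over all faithful covariants $\varphi$ of $G$. *)

theory Defs
  imports
    Jordan_Normal_Form.Matrix
    "HOL-Algebra.Elementary_Groups"
    "HOL-Analysis.Abstract_Topology"
    "HOL-Library.Extended_Nat"
begin

section \<open>Polynomial maps between complex affine spaces\<close>

text \<open>Affine \<open>n\<close>-space is \<open>carrier_vec n\<close>. A member of \<open>poly_funs n\<close> is a function on all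
  vectors, but only its values on \<open>carrier_vec n\<close> matter.\<close>

inductive_set poly_funs :: "nat \<Rightarrow> (complex vec \<Rightarrow> complex) set" for n :: nat where
  const: "(\<lambda>v. c) \<in> poly_funs n"
| coord: "i < n \<Longrightarrow> (\<lambda>v. v $ i) \<in> poly_funs n"
| add: "p \<in> poly_funs n \<Longrightarrow> q \<in> poly_funs n \<Longrightarrow> (\<lambda>v. p v + q v) \<in> poly_funs n"
| mult: "p \<in> poly_funs n \<Longrightarrow> q \<in> poly_funs n \<Longrightarrow> (\<lambda>v. p v * q v) \<in> poly_funs n"

definition poly_map :: "nat \<Rightarrow> nat \<Rightarrow> (complex vec \<Rightarrow> complex vec) \<Rightarrow> bool" where
  "poly_map n m \<phi> \<longleftrightarrow>
     \<phi> \<in> carrier_vec n \<rightarrow> carrier_vec m \<and>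
     (\<forall>i<m. \<exists>p\<in>poly_funs n. \<forall>v\<in>carrier_vec n. \<phi> v $ i = p v)"


section \<open>The Zariski topology\<close>

definition zero_locus :: "nat \<Rightarrow> (complex vec \<Rightarrow> complex) set \<Rightarrow> complex vec set" where
  "zero_locus n F = {v \<in> carrier_vec n. \<forall>p\<in>F. p v = 0}"

definition zariski :: "nat \<Rightarrow> complex vec topology" where
  "zariski n = topology (\<lambda>U. \<exists>F\<subseteq>poly_funs n. U = carrier_vec n - zero_locus n F)"

lemma istopology_zariski:
  "istopology (\<lambda>U. \<exists>F\<subseteq>poly_funs n. U = carrier_vec n - zero_locus n F)"
  unfolding istopology_def
proof (intro conjI allI impI)
  fix S T
  assume "\<exists>F\<subseteq>poly_funs n. S = carrier_vec n - zero_locus n F"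
    and "\<exists>F\<subseteq>poly_funs n. T = carrier_vec n - zero_locus n F"
  then obtain F G where F: "F \<subseteq> poly_funs n" "S = carrier_vec n - zero_locus n F"
    and G: "G \<subseteq> poly_funs n" "T = carrier_vec n - zero_locus n G"
    by blast
  let ?H = "{\<lambda>v. p v * q v | p q. p \<in> F \<and> q \<in> G}"
  have "?H \<subseteq> poly_funs n"
    using F G by (blast intro: poly_funs.mult)
  moreover have "S \<inter> T = carrier_vec n - zero_locus n ?H"
    unfolding F G zero_locus_def by fastforce
  ultimately show "\<exists>F\<subseteq>poly_funs n. S \<inter> T = carrier_vec n - zero_locus n F"
    by blast
next
  fix \<K> :: "complex vec set set"
  assume "\<forall>K\<in>\<K>. \<exists>F\<subseteq>poly_funs n. K = carrier_vec n - zero_locus n F"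
  then obtain F where F: "\<And>K. K \<in> \<K> \<Longrightarrow> F K \<subseteq> poly_funs n"
    "\<And>K. K \<in> \<K> \<Longrightarrow> K = carrier_vec n - zero_locus n (F K)"
    by metis
  have "\<Union>\<K> = (\<Union>K\<in>\<K>. carrier_vec n - zero_locus n (F K))"
    using F(2) by auto
  also have "\<dots> = carrier_vec n - zero_locus n (\<Union>(F ` \<K>))"
    unfolding zero_locus_def by auto
  finally have "\<Union>\<K> = carrier_vec n - zero_locus n (\<Union>(F ` \<K>))" .
  moreover have "\<Union>(F ` \<K>) \<subseteq> poly_funs n"
    using F(1) by blast
  ultimately show "\<exists>F\<subseteq>poly_funs n. \<Union>\<K> = carrier_vec n - zero_locus n F"
    by blast
qed

lemma openin_zariski:
  "openin (zariski n) U \<longleftrightarrow> (\<exists>F\<subseteq>poly_funs n. U = carrier_vec n - zero_locus n F)"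
  unfolding zariski_def by (simp add: topology_inverse'[OF istopology_zariski])

lemma topspace_zariski [simp]: "topspace (zariski n) = carrier_vec n"
proof -
  have "carrier_vec n = carrier_vec n - zero_locus n {\<lambda>v. 1}"
    by (auto simp: zero_locus_def)
  moreover have "{\<lambda>v. 1} \<subseteq> poly_funs n"
    by (simp add: poly_funs.const)
  ultimately have "openin (zariski n) (carrier_vec n)"
    unfolding openin_zariski by blast
  then have "carrier_vec n \<subseteq> topspace (zariski n)"
    by (rule openin_subset)
  moreover have "topspace (zariski n) \<subseteq> carrier_vec n"
    unfolding topspace_def openin_zariski by blast
  ultimately show ?thesis
    by blast
qed

lemma closedin_zariski:
  "closedin (zariski n) S \<longleftrightarrow> (\<exists>F\<subseteq>poly_funs n. S = zero_locus n F)"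
proof -
  have "zero_locus n F \<subseteq> carrier_vec n" for F
    by (auto simp: zero_locus_def)
  then show ?thesis
    unfolding closedin_def openin_zariski topspace_zariski
    by (metis double_diff order_refl)
qed


section \<open>Irreducibility and Krull dimension\<close>

definition irreducible_space :: "'a topology \<Rightarrow> bool" where
  "irreducible_space X \<longleftrightarrow>
     topspace X \<noteq> {} \<and>
     (\<forall>A B. closedin X A \<longrightarrow> closedin X B \<longrightarrow> A \<union> B = topspace X \<longrightarrow>
        A = topspace X \<or> B = topspace X)"

text \<open>The supremum of the lengths \<open>k\<close> of chains \<open>Z 0 \<subset> Z 1 \<subset> \<dots> \<subset> Z k\<close> of irreducible closed
  subsets. The empty space gets dimension 0, but images of modules are never empty.\<close>

definition krull_dim :: "'a topology \<Rightarrow> enat" where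
  "krull_dim X = Sup {enat k | k. \<exists>Z :: nat \<Rightarrow> 'a set.
     (\<forall>i\<le>k. closedin X (Z i) \<and> irreducible_space (subtopology X (Z i))) \<and>
     (\<forall>i<k. Z i \<subset> Z (Suc i))}"


section \<open>Modules and covariants\<close>

text \<open>After a choice of basis, an \<open>n\<close>-dimensional \<open>G\<close>-module over the complex numbers is
  \<open>carrier_vec n\<close> with \<open>g\<close> acting as multiplication by the matrix \<open>\<rho> g\<close>.\<close>

definition G_module :: "'a monoid \<Rightarrow> nat \<Rightarrow> ('a \<Rightarrow> complex mat) \<Rightarrow> bool" where
  "G_module G n \<rho> \<longleftrightarrow>
     \<rho> \<in> carrier G \<rightarrow> carrier_mat n n \<and>
     \<rho> \<one>\<^bsub>G\<^esub> = 1\<^sub>m n \<and>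
     (\<forall>g\<in>carrier G. \<forall>h\<in>carrier G. \<rho> (g \<otimes>\<^bsub>G\<^esub> h) = \<rho> g * \<rho> h)"

definition covariant ::
  "'a monoid \<Rightarrow> nat \<Rightarrow> ('a \<Rightarrow> complex mat) \<Rightarrow> nat \<Rightarrow> ('a \<Rightarrow> complex mat) \<Rightarrow>
     (complex vec \<Rightarrow> complex vec) \<Rightarrow> bool" where
  "covariant G n \<rho> m \<sigma> \<phi> \<longleftrightarrow>
     G_module G n \<rho> \<and> G_module G m \<sigma> \<and> poly_map n m \<phi> \<and>
     (\<forall>g\<in>carrier G. \<forall>v\<in>carrier_vec n. \<phi> (\<rho> g *\<^sub>v v) = \<sigma> g *\<^sub>v \<phi> v)"

definition faithful_covariant ::
  "'a monoid \<Rightarrow> nat \<Rightarrow> ('a \<Rightarrow> complex mat) \<Rightarrow> nat \<Rightarrow> ('a \<Rightarrow> complex mat) \<Rightarrow>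
     (complex vec \<Rightarrow> complex vec) \<Rightarrow> bool" where
  "faithful_covariant G n \<rho> m \<sigma> \<phi> \<longleftrightarrow>
     covariant G n \<rho> m \<sigma> \<phi> \<and>
     (\<forall>g\<in>carrier G. (\<forall>w\<in>\<phi> ` carrier_vec n. \<sigma> g *\<^sub>v w = w) \<longrightarrow> g = \<one>\<^bsub>G\<^esub>)"

definition map_dim :: "nat \<Rightarrow> nat \<Rightarrow> (complex vec \<Rightarrow> complex vec) \<Rightarrow> enat" where
  "map_dim n m \<phi> =
     krull_dim (subtopology (zariski m) (zariski m closure_of (\<phi> ` carrier_vec n)))"

text \<open>Since \<^typ>\<open>enat\<close> is well-ordered, the infimum of a nonempty set is its minimum; it would be
  \<open>\<infinity>\<close> if there were no faithful covariant.\<close>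

definition covdim :: "'a monoid \<Rightarrow> enat" where
  "covdim G = Inf {map_dim n m \<phi> | n \<rho> m \<sigma> \<phi>. faithful_covariant G n \<rho> m \<sigma> \<phi>}"

end

theory Submission
  imports Defs "HOL-Algebra.Multiplicative_Group" "HOL-Computational_Algebra.Polynomial"
begin

text \<open>Let \<open>\<phi>\<close> be a faithful covariant whose image has closure \<open>X\<close> of dimension 1, and let \<open>A\<close> be the
  algebra of functions on \<open>V\<close> pulled back along \<open>\<phi>\<close>. The image of any line through the origin on
  which \<open>\<phi>\<close> is not constant is dense in \<open>X\<close>, so two elements of \<open>A\<close>, being algebraically dependent
  on such a line, are algebraically dependent on \<open>V\<close>. Hence their lowest homogeneous forms are
  algebraically dependent too, and lowest forms of the same degree \<open>d\<close> are proportional. So \<open>G\<close>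
  acts on the lowest forms of degree \<open>d\<close> by a character \<open>\<chi> d\<close>, with
  \<open>\<chi> (d + e) = \<chi> d * \<chi> e\<close>. As \<open>G\<close> is finite, an element in the kernel of every \<open>\<chi> d\<close> acts trivially
  on \<open>A\<close>, hence is the identity. All \<open>\<chi> d\<close> are powers of a single character of \<open>G\<close>, attached to the
  gcd of the degrees that occur, and this character is therefore injective.\<close>

section \<open>Regular functions\<close>

text \<open>Pullbacks and homogeneous components agree with a member of \<open>poly_funs n\<close>
  only on \<open>carrier_vec n\<close>, so the class is closed under such agreement.\<close>

definition regular_funs :: "nat \<Rightarrow> (complex vec \<Rightarrow> complex) set" where
  "regular_funs n = {f. \<exists>p\<in>poly_funs n. \<forall>v\<in>carrier_vec n. f v = p v}"

lemma regular_funs_of_poly: "p \<in> poly_funs n \<Longrightarrow> p \<in> regular_funs n"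
  unfolding regular_funs_def by blast

lemma regular_funs_cong:
  assumes "f \<in> regular_funs n" "\<And>v. v \<in> carrier_vec n \<Longrightarrow> g v = f v"
  shows "g \<in> regular_funs n"
  using assms unfolding regular_funs_def by auto

lemma regular_funs_const [intro, simp]: "(\<lambda>v. c) \<in> regular_funs n"
  by (intro regular_funs_of_poly poly_funs.const)

lemma regular_funs_add [intro]:
  assumes "f \<in> regular_funs n" "g \<in> regular_funs n"
  shows "(\<lambda>v. f v + g v) \<in> regular_funs n"
proof -
  obtain p q where "p \<in> poly_funs n" "q \<in> poly_funs n"
    "\<forall>v\<in>carrier_vec n. f v = p v" "\<forall>v\<in>carrier_vec n. g v = q v"
    using assms unfolding regular_funs_def by blast
  then show ?thesis
    unfolding regular_funs_def using poly_funs.add[of p n q] by auto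
qed

lemma regular_funs_mult [intro]:
  assumes "f \<in> regular_funs n" "g \<in> regular_funs n"
  shows "(\<lambda>v. f v * g v) \<in> regular_funs n"
proof -
  obtain p q where "p \<in> poly_funs n" "q \<in> poly_funs n"
    "\<forall>v\<in>carrier_vec n. f v = p v" "\<forall>v\<in>carrier_vec n. g v = q v"
    using assms unfolding regular_funs_def by blast
  then show ?thesis
    unfolding regular_funs_def using poly_funs.mult[of p n q] by auto
qed

lemma regular_funs_diff [intro]:
  assumes "f \<in> regular_funs n" "g \<in> regular_funs n"
  shows "(\<lambda>v. f v - g v) \<in> regular_funs n"
proof -
  have "(\<lambda>v. f v + (- 1) * g v) \<in> regular_funs n"
    using assms by (intro regular_funs_add regular_funs_mult regular_funs_const)
  then show ?thesis by simp
qed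

lemma regular_funs_power [intro]:
  "f \<in> regular_funs n \<Longrightarrow> (\<lambda>v. f v ^ k) \<in> regular_funs n"
  by (induction k) auto

lemma regular_funs_sum [intro]:
  "(\<And>i. i \<in> I \<Longrightarrow> f i \<in> regular_funs n) \<Longrightarrow> (\<lambda>v. \<Sum>i\<in>I. f i v) \<in> regular_funs n"
  by (induction I rule: infinite_finite_induct) auto

lemma regular_funs_coord: "i < n \<Longrightarrow> (\<lambda>v. v $ i) \<in> regular_funs n"
  by (intro regular_funs_of_poly poly_funs.coord)

lemma regular_funs_induct [consumes 1, case_names const coord add mult cong]:
  assumes "f \<in> regular_funs n"
    and "\<And>c. P (\<lambda>v. c)"
    and "\<And>i. i < n \<Longrightarrow> P (\<lambda>v. v $ i)"
    and "\<And>f g. f \<in> regular_funs n \<Longrightarrow> g \<in> regular_funs n \<Longrightarrow> P f \<Longrightarrow> P g \<Longrightarrow> P (\<lambda>v. f v + g v)"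
    and "\<And>f g. f \<in> regular_funs n \<Longrightarrow> g \<in> regular_funs n \<Longrightarrow> P f \<Longrightarrow> P g \<Longrightarrow> P (\<lambda>v. f v * g v)"
    and cong: "\<And>f g. P f \<Longrightarrow> (\<And>v. v \<in> carrier_vec n \<Longrightarrow> g v = f v) \<Longrightarrow> P g"
  shows "P f"
proof -
  obtain p where p: "p \<in> poly_funs n" "\<forall>v\<in>carrier_vec n. f v = p v"
    using assms(1) unfolding regular_funs_def by blast
  from p(1) have "P p"
    by induction (use assms regular_funs_of_poly in auto)
  then show ?thesis
    using cong p(2) by blast
qed

lemma regular_funs_compose:
  assumes "f \<in> regular_funs m" "poly_map n m \<psi>"
  shows "(\<lambda>v. f (\<psi> v)) \<in> regular_funs n"
  using assms(1)
proof (induction rule: regular_funs_induct)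
  case (coord i)
  then show ?case
    using assms(2) unfolding poly_map_def regular_funs_def by auto
next
  case (cong f g)
  have "\<psi> v \<in> carrier_vec m" if "v \<in> carrier_vec n" for v
    using assms(2) that unfolding poly_map_def by blast
  then show ?case
    using cong regular_funs_cong[of "\<lambda>v. f (\<psi> v)" n "\<lambda>v. g (\<psi> v)"] by simp
qed auto

lemma poly_map_mult_mat_vec:
  assumes "M \<in> carrier_mat m n"
  shows "poly_map n m (\<lambda>v. M *\<^sub>v v)"
  unfolding poly_map_def
proof (intro conjI allI impI)
  show "(\<lambda>v. M *\<^sub>v v) \<in> carrier_vec n \<rightarrow> carrier_vec m"
    using assms by auto
  fix i assume i: "i < m"
  have "(\<lambda>v. \<Sum>j\<in>{0..<n}. M $$ (i, j) * v $ j) \<in> regular_funs n"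
    by (intro regular_funs_sum regular_funs_mult regular_funs_const regular_funs_coord) auto
  moreover have "(M *\<^sub>v v) $ i = (\<Sum>j\<in>{0..<n}. M $$ (i, j) * v $ j)" if "v \<in> carrier_vec n" for v
    using assms i that by (auto simp: scalar_prod_def intro!: sum.cong)
  ultimately show "\<exists>p\<in>poly_funs n. \<forall>v\<in>carrier_vec n. (M *\<^sub>v v) $ i = p v"
    unfolding regular_funs_def by force
qed


section \<open>Restriction to lines and homogeneous components\<close>

text \<open>The description is unique because a complex polynomial is determined by its values.
  Restricting to lines reduces arguments in several variables to univariate ones.\<close>

definition line_poly :: "(complex vec \<Rightarrow> complex) \<Rightarrow> complex vec \<Rightarrow> complex vec \<Rightarrow> complex poly" where
  "line_poly f w v = (THE P. \<forall>t. poly P t = f (w + t \<cdot>\<^sub>v v))"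

lemma line_poly_eqI: "(\<And>t. poly P t = f (w + t \<cdot>\<^sub>v v)) \<Longrightarrow> line_poly f w v = P"
  unfolding line_poly_def
proof (rule the_equality)
  fix Q :: "complex poly"
  assume "\<And>t. poly P t = f (w + t \<cdot>\<^sub>v v)" "\<forall>t. poly Q t = f (w + t \<cdot>\<^sub>v v)"
  then have "poly Q = poly P" by fastforce
  then show "Q = P" by (simp add: poly_eq_poly_eq_iff)
qed auto

lemma poly_line_poly:
  assumes "f \<in> regular_funs n" "w \<in> carrier_vec n" "v \<in> carrier_vec n"
  shows "poly (line_poly f w v) t = f (w + t \<cdot>\<^sub>v v)"
proof -
  have "\<exists>P. \<forall>t. poly P t = f (w + t \<cdot>\<^sub>v v)"
    using assms(1)
  proof (induction rule: regular_funs_induct)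
    case (const c)
    show ?case by (rule exI[of _ "[:c:]"]) simp
  next
    case (coord i)
    then show ?case
      using assms by (intro exI[of _ "[:w $ i, v $ i:]"]) simp
  next
    case (add f g)
    then obtain P Q where "\<forall>t. poly P t = f (w + t \<cdot>\<^sub>v v)" "\<forall>t. poly Q t = g (w + t \<cdot>\<^sub>v v)"
      by blast
    then show ?case by (intro exI[of _ "P + Q"]) simp
  next
    case (mult f g)
    then obtain P Q where "\<forall>t. poly P t = f (w + t \<cdot>\<^sub>v v)" "\<forall>t. poly Q t = g (w + t \<cdot>\<^sub>v v)"
      by blast
    then show ?case by (intro exI[of _ "P * Q"]) simp
  next
    case (cong f g)
    then show ?case using assms by auto
  qed
  then show ?thesis
    using line_poly_eqI by blast
qed

abbreviation ray_poly :: "nat \<Rightarrow> (complex vec \<Rightarrow> complex) \<Rightarrow> complex vec \<Rightarrow> complex poly" where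
  "ray_poly n f \<equiv> line_poly f (0\<^sub>v n)"

lemma poly_ray_poly:
  assumes "f \<in> regular_funs n" "v \<in> carrier_vec n"
  shows "poly (ray_poly n f v) t = f (t \<cdot>\<^sub>v v)"
  using poly_line_poly[OF assms(1) _ assms(2), of "0\<^sub>v n" t] assms(2) by simp

lemma ray_poly_eqI:
  "v \<in> carrier_vec n \<Longrightarrow> (\<And>t. poly P t = f (t \<cdot>\<^sub>v v)) \<Longrightarrow> ray_poly n f v = P"
  by (rule line_poly_eqI) simp

text \<open>The value at \<open>v\<close> of the degree \<open>d\<close> homogeneous component of \<open>f\<close> is the coefficient of
  \<open>t ^ d\<close> in \<open>f (t v)\<close>.\<close>

definition hom_comp :: "nat \<Rightarrow> (complex vec \<Rightarrow> complex) \<Rightarrow> nat \<Rightarrow> complex vec \<Rightarrow> complex" where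
  "hom_comp n f d v = coeff (ray_poly n f v) d"

lemma ray_poly_mult:
  assumes "f \<in> regular_funs n" "g \<in> regular_funs n" "v \<in> carrier_vec n"
  shows "ray_poly n (\<lambda>v. f v * g v) v = ray_poly n f v * ray_poly n g v"
  by (rule ray_poly_eqI) (use assms in \<open>auto simp: poly_ray_poly\<close>)

text \<open>Induction on the construction of \<open>f\<close>. The components of a product form a
  Cauchy product, which involves all degrees up to \<open>d\<close>; hence \<open>d\<close> is
  arbitrary in the induction.\<close>

lemma hom_comp_regular:
  assumes "f \<in> regular_funs n"
  shows "hom_comp n f d \<in> regular_funs n"
  using assms
proof (induction arbitrary: d rule: regular_funs_induct)
  case (const c)
  have "hom_comp n (\<lambda>v. c) d v = coeff [:c:] d" if "v \<in> carrier_vec n" for v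
    unfolding hom_comp_def using that by (subst ray_poly_eqI[of _ _ "[:c:]"]) auto
  then show ?case by (rule regular_funs_cong[OF regular_funs_const])
next
  case (coord i)
  have "hom_comp n (\<lambda>v. v $ i) d v = (if d = 1 then v $ i else 0)" if "v \<in> carrier_vec n" for v
    unfolding hom_comp_def using that coord
    by (subst ray_poly_eqI[of _ _ "[:0, v $ i:]"]) (auto split: nat.splits simp: coeff_pCons)
  moreover have "(\<lambda>v. if d = 1 then v $ i else 0) \<in> regular_funs n"
    using coord regular_funs_coord by (cases "d = 1") auto
  ultimately show ?case by (rule regular_funs_cong[rotated])
next
  case (add f g)
  have "hom_comp n (\<lambda>v. f v + g v) d v = hom_comp n f d v + hom_comp n g d v"
    if "v \<in> carrier_vec n" for v
    unfolding hom_comp_def using that add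
    by (subst ray_poly_eqI[of _ _ "ray_poly n f v + ray_poly n g v"]) (auto simp: poly_ray_poly)
  then show ?case
    by (rule regular_funs_cong[rotated]) (use add in auto)
next
  case (mult f g)
  have "hom_comp n (\<lambda>v. f v * g v) d v = (\<Sum>i\<le>d. hom_comp n f i v * hom_comp n g (d - i) v)"
    if "v \<in> carrier_vec n" for v
    unfolding hom_comp_def using that mult by (simp add: ray_poly_mult coeff_mult)
  then show ?case
    by (rule regular_funs_cong[rotated]) (use mult in \<open>auto intro!: regular_funs_sum regular_funs_mult\<close>)
next
  case (cong f g)
  have "hom_comp n g d v = hom_comp n f d v" if "v \<in> carrier_vec n" for v
    using cong(2) that unfolding hom_comp_def line_poly_def by simp
  then show ?case
    by (rule regular_funs_cong[rotated]) (use cong in auto)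
qed

text \<open>This is the irreducibility of the line: two nonempty open subsets meet. It is the source
  of every irreducibility and nonvanishing argument below.\<close>

lemma poly_common_nonroot:
  fixes P Q :: "complex poly"
  assumes "poly P s \<noteq> 0" "poly Q t \<noteq> 0"
  obtains x where "poly P x \<noteq> 0" "poly Q x \<noteq> 0"
proof -
  have "P * Q \<noteq> 0" using assms by auto
  then have "\<exists>x. poly (P * Q) x \<noteq> 0"
    using poly_all_0_iff_0 by blast
  then show ?thesis using that by auto
qed


section \<open>Irreducible closed sets\<close>

lemma closure_zariski_vanish:
  assumes "p \<in> poly_funs m" "\<And>s. s \<in> S \<Longrightarrow> p s = 0" "x \<in> zariski m closure_of S"
  shows "p x = 0"
proof -
  have "zariski m closure_of S = zariski m closure_of (carrier_vec m \<inter> S)"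
    by (metis closure_of_restrict topspace_zariski)
  also have "\<dots> \<subseteq> zero_locus m {p}"
    by (rule closure_of_minimal) (use assms closedin_zariski in \<open>auto simp: zero_locus_def\<close>)
  finally show ?thesis
    using assms(3) by (auto simp: zero_locus_def)
qed

text \<open>If two proper closed subsets covered the closure, there would be polynomials vanishing
  on them but not at the images of some \<open>v\<close> and \<open>w\<close> in \<open>L\<close>.
  On the line joining \<open>v\<close> and \<open>w\<close> both pull back to nonzero polynomials,
  and a common nonroot gives an image point outside both subsets. The form of \<open>affine\<close>
  covers a point, a line and the whole space alike.\<close>

lemma irreducible_closure_image:
  assumes \<phi>: "poly_map n m \<phi>" and L: "L \<subseteq> carrier_vec n" "L \<noteq> {}"
    and affine: "\<And>v w t. v \<in> L \<Longrightarrow> w \<in> L \<Longrightarrow> v + t \<cdot>\<^sub>v (w - v) \<in> L"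
  shows "irreducible_space (subtopology (zariski m) (zariski m closure_of (\<phi> ` L)))"
proof -
  let ?S = "\<phi> ` L"
  let ?C = "zariski m closure_of ?S"
  have S: "?S \<subseteq> carrier_vec m" using \<phi> L unfolding poly_map_def by auto
  then have SC: "?S \<subseteq> ?C" by (simp add: closure_of_subset)
  have C: "?C \<subseteq> carrier_vec m" using closure_of_subset_topspace[of "zariski m" ?S] by simp
  \<comment> \<open>A proper closed subset of the closure must miss a point of the image itself, or
    it would contain the closure.\<close>
  have witness: "\<exists>p\<in>poly_funs m. (\<forall>x\<in>A. p x = 0) \<and> (\<exists>v\<in>L. p (\<phi> v) \<noteq> 0)"
    if A: "closedin (subtopology (zariski m) ?C) A" and ne: "A \<noteq> ?C" for A
  proof -
    have cl: "closedin (zariski m) A"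
      using A closedin_closure_of by (rule closedin_trans_full)
    then obtain F where F: "F \<subseteq> poly_funs m" "A = zero_locus m F"
      unfolding closedin_zariski by blast
    have "A \<subseteq> ?C"
      using closedin_subset[OF A] by simp
    then have "\<not> ?S \<subseteq> A"
      using closure_of_minimal[OF _ cl, of ?S] ne by blast
    then obtain v where "v \<in> L" "\<phi> v \<notin> A" by blast
    then obtain p where "p \<in> F" "p (\<phi> v) \<noteq> 0"
      using S F(2) unfolding zero_locus_def by auto
    then show ?thesis
      using F \<open>v \<in> L\<close> unfolding zero_locus_def by auto
  qed
  show ?thesis
    unfolding irreducible_space_def
  proof (intro conjI allI impI)
    show "topspace (subtopology (zariski m) ?C) \<noteq> {}"
      using L C SC by auto
    fix A B
    assume A: "closedin (subtopology (zariski m) ?C) A"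
      and B: "closedin (subtopology (zariski m) ?C) B"
      and AB: "A \<union> B = topspace (subtopology (zariski m) ?C)"
    have top: "topspace (subtopology (zariski m) ?C) = ?C"
      using C by auto
    show "A = topspace (subtopology (zariski m) ?C) \<or> B = topspace (subtopology (zariski m) ?C)"
    proof (rule ccontr)
      assume "\<not> ?thesis"
      then have "A \<noteq> ?C" "B \<noteq> ?C" using top by auto
      then obtain p q v w where p: "p \<in> poly_funs m" "\<forall>x\<in>A. p x = 0" "v \<in> L" "p (\<phi> v) \<noteq> 0"
        and q: "q \<in> poly_funs m" "\<forall>x\<in>B. q x = 0" "w \<in> L" "q (\<phi> w) \<noteq> 0"
        using witness[OF A] witness[OF B] by metis
      have vw: "v \<in> carrier_vec n" "w \<in> carrier_vec n" using p(3) q(3) L(1) by auto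
      then have wv: "w - v \<in> carrier_vec n" by simp
      let ?P = "line_poly (\<lambda>v. p (\<phi> v)) v (w - v)" and ?Q = "line_poly (\<lambda>v. q (\<phi> v)) v (w - v)"
      have P: "poly ?P t = p (\<phi> (v + t \<cdot>\<^sub>v (w - v)))" and Q: "poly ?Q t = q (\<phi> (v + t \<cdot>\<^sub>v (w - v)))" for t
        using poly_line_poly[OF regular_funs_compose[OF regular_funs_of_poly \<phi>] vw(1) wv] p(1) q(1)
        by blast+
      have "v + 0 \<cdot>\<^sub>v (w - v) = v" "v + 1 \<cdot>\<^sub>v (w - v) = w"
        using vw by (auto intro!: eq_vecI)
      then have "poly ?P 0 \<noteq> 0" "poly ?Q 1 \<noteq> 0"
        using P Q p q by auto
      then obtain t where "poly ?P t \<noteq> 0" "poly ?Q t \<noteq> 0"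
        using poly_common_nonroot by blast
      moreover have "\<phi> (v + t \<cdot>\<^sub>v (w - v)) \<in> A \<union> B"
        using SC affine[OF p(3) q(3)] AB top by auto
      ultimately show False
        using P Q p q by auto
    qed
  qed
qed

lemma krull_dim_ge_2:
  assumes "closedin X Z0" "closedin X Z1" "closedin X Z2"
    and "irreducible_space (subtopology X Z0)" "irreducible_space (subtopology X Z1)"
      "irreducible_space (subtopology X Z2)"
    and "Z0 \<subset> Z1" "Z1 \<subset> Z2"
  shows "2 \<le> krull_dim X"
proof -
  define Z where "Z = (\<lambda>i::nat. if i = 0 then Z0 else if i = 1 then Z1 else Z2)"
  have "enat 2 \<le> krull_dim X"
    unfolding krull_dim_def
  proof (intro Sup_upper CollectI exI[of _ 2] exI[of _ Z] conjI refl)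
    show "\<forall>i\<le>2. closedin X (Z i) \<and> irreducible_space (subtopology X (Z i))"
      using assms by (auto simp: Z_def)
    show "\<forall>i<2. Z i \<subset> Z (Suc i)"
      using assms by (auto simp: Z_def less_2_cases_iff)
  qed
  then show ?thesis by (simp add: numeral_eq_enat)
qed

text \<open>Otherwise the closures of the images of the origin, the line and the whole space would form
  a chain of length 2.\<close>

lemma vanish_on_ray_imp_vanish:
  assumes \<phi>: "poly_map n m \<phi>" and dim: "map_dim n m \<phi> = 1"
    and f: "f \<in> regular_funs m" and h: "h \<in> regular_funs m"
    and v: "v \<in> carrier_vec n"
    and nonconst: "h (\<phi> (t \<cdot>\<^sub>v v)) \<noteq> h (\<phi> (0\<^sub>v n))"
    and vanish: "\<And>s. f (\<phi> (s \<cdot>\<^sub>v v)) = 0"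
    and w: "w \<in> carrier_vec n"
  shows "f (\<phi> w) = 0"
proof (rule ccontr)
  assume fw: "f (\<phi> w) \<noteq> 0"
  let ?L = "range (\<lambda>s. s \<cdot>\<^sub>v v)"
  let ?cl = "\<lambda>L. zariski m closure_of (\<phi> ` L)"
  let ?X = "subtopology (zariski m) (?cl (carrier_vec n))"
  have \<phi>c: "\<phi> x \<in> carrier_vec m" if "x \<in> carrier_vec n" for x
    using \<phi> that unfolding poly_map_def by auto
  have L: "?L \<subseteq> carrier_vec n" using v by auto
  have "0\<^sub>v n = 0 \<cdot>\<^sub>v v" using v by (intro eq_vecI) auto
  then have L0: "{0\<^sub>v n} \<subseteq> ?L" by blast
  obtain p where p: "p \<in> poly_funs m" "\<And>x. x \<in> carrier_vec m \<Longrightarrow> p x = f x"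
    using f unfolding regular_funs_def by auto
  \<comment> \<open>Shifted to vanish at the image of the origin, \<open>h\<close> yields a
    polynomial \<open>q\<close> separating the first two closures of the chain; \<open>p\<close>
    separates the last two.\<close>
  have "(\<lambda>x. h x - h (\<phi> (0\<^sub>v n))) \<in> regular_funs m"
    using h by auto
  then obtain q where q: "q \<in> poly_funs m"
    "\<And>x. x \<in> carrier_vec m \<Longrightarrow> q x = h x - h (\<phi> (0\<^sub>v n))"
    unfolding regular_funs_def by auto
  have mono: "?cl K \<subseteq> ?cl L" if "K \<subseteq> L" for K L
    using that by (intro closure_of_mono image_mono)
  have mem: "\<phi> x \<in> ?cl L" if "x \<in> L" "L \<subseteq> carrier_vec n" for x L
    using closure_of_subset[of "\<phi> ` L" "zariski m"] that \<phi>c by auto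
  have strict1: "?cl {0\<^sub>v n} \<subset> ?cl ?L"
  proof -
    have "\<phi> (t \<cdot>\<^sub>v v) \<notin> ?cl {0\<^sub>v n}"
    proof
      assume "\<phi> (t \<cdot>\<^sub>v v) \<in> ?cl {0\<^sub>v n}"
      then have "q (\<phi> (t \<cdot>\<^sub>v v)) = 0"
        by (rule closure_zariski_vanish[OF q(1), rotated]) (auto simp: q(2) \<phi>c)
      then show False using q(2) \<phi>c v nonconst by auto
    qed
    then show ?thesis using mono[OF L0] mem[OF _ L, of "t \<cdot>\<^sub>v v"] by blast
  qed
  have strict2: "?cl ?L \<subset> ?cl (carrier_vec n)"
  proof -
    have "\<phi> w \<notin> ?cl ?L"
    proof
      assume "\<phi> w \<in> ?cl ?L"
      then have "p (\<phi> w) = 0"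
        by (rule closure_zariski_vanish[OF p(1), rotated]) (use v vanish in \<open>auto simp: p(2) \<phi>c\<close>)
      then show False using p(2) \<phi>c w fw by auto
    qed
    then show ?thesis using mono[OF L] mem[OF w] by blast
  qed
  have closed: "closedin ?X (?cl K)" if "K \<subseteq> carrier_vec n" for K
    by (rule closedin_subset_topspace[OF closedin_closure_of mono[OF that]])
  have sub: "subtopology ?X (?cl K) = subtopology (zariski m) (?cl K)" if "K \<subseteq> carrier_vec n" for K
    unfolding subtopology_subtopology inf_absorb2[OF mono[OF that]] by (rule refl)
  have "2 \<le> krull_dim ?X"
  proof (rule krull_dim_ge_2[OF closed closed closed _ _ _ strict1 strict2])
    show "irreducible_space (subtopology ?X (?cl {0\<^sub>v n}))"
      unfolding sub[OF order.trans[OF L0 L]]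
      by (rule irreducible_closure_image[OF \<phi>]) auto
    have "s \<cdot>\<^sub>v v + r \<cdot>\<^sub>v (s' \<cdot>\<^sub>v v - s \<cdot>\<^sub>v v) = (s + r * (s' - s)) \<cdot>\<^sub>v v" for s r s'
      using v by (intro eq_vecI) (auto simp: algebra_simps)
    then show "irreducible_space (subtopology ?X (?cl ?L))"
      unfolding sub[OF L]
      by (intro irreducible_closure_image[OF \<phi> L]) auto
    show "irreducible_space (subtopology ?X (?cl (carrier_vec n)))"
      unfolding sub[OF order.refl]
      by (rule irreducible_closure_image[OF \<phi>]) (auto intro: zero_carrier_vec)
  qed (use L L0 in auto)
  then show False
    using dim unfolding map_dim_def by (auto simp: one_enat_def numeral_eq_enat)
qed


section \<open>Algebraic dependence of univariate polynomials\<close>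

text \<open>Polynomials of degree below \<open>K\<close> are spanned by \<open>K\<close> monomials.
  Linear dependence in the vector space concerns sets, so a family with a repeated member is treated
  apart, with coefficients 1 and -1.\<close>

lemma poly_family_dependent:
  fixes u :: "'i \<Rightarrow> 'a::field poly"
  assumes I: "finite I" "K < card I" and deg: "\<And>i. i \<in> I \<Longrightarrow> degree (u i) < K"
  shows "\<exists>c. (\<exists>i\<in>I. c i \<noteq> 0) \<and> (\<Sum>i\<in>I. smult (c i) (u i)) = 0"
proof (cases "inj_on u I")
  case True
  interpret vector_space "smult :: 'a \<Rightarrow> 'a poly \<Rightarrow> 'a poly"
    by unfold_locales (simp_all add: smult_add_right smult_add_left)
  let ?T = "(\<lambda>i. monom 1 i) ` {..<K} :: 'a poly set"
  have "p \<in> span ?T" if "degree p < K" for p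
  proof -
    have "(\<Sum>i\<le>degree p. smult (coeff p i) (monom 1 i)) \<in> span ?T"
      using that by (intro span_sum span_scale span_base) auto
    then show ?thesis
      by (simp add: smult_monom poly_as_sum_of_monoms)
  qed
  then have "u ` I \<subseteq> span ?T"
    using deg by blast
  moreover have "card ?T \<le> K"
    using card_image_le[of "{..<K}" "\<lambda>i. monom (1::'a) i"] by simp
  ultimately have "dependent (u ` I)"
    using independent_span_bound[of ?T "u ` I"] I card_image[OF True] by force
  then obtain c where c: "\<exists>p\<in>u ` I. c p \<noteq> 0" "(\<Sum>p\<in>u ` I. smult (c p) p) = 0"
    using dependent_finite[of "u ` I"] I(1) by auto
  show ?thesis
    using c by (intro exI[of _ "c \<circ> u"]) (auto simp: sum.reindex[OF True])
next
  case False
  then obtain i j where ij: "i \<in> I" "j \<in> I" "i \<noteq> j" "u i = u j"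
    unfolding inj_on_def by blast
  define c where "c = (\<lambda>k. if k = i then 1 else if k = j then - 1 else 0 :: 'a)"
  have "(\<Sum>k\<in>I. smult (c k) (u k)) = (\<Sum>k\<in>{i, j}. smult (c k) (u k))"
    using ij I by (intro sum.mono_neutral_right) (auto simp: c_def)
  also have "\<dots> = 0"
    using ij by (simp add: c_def)
  finally show ?thesis
    using ij by (intro exI[of _ c]) (auto simp: c_def)
qed

lemma poly_algebraically_dependent:
  fixes F H :: "'a::field poly"
  obtains N and c :: "nat \<Rightarrow> nat \<Rightarrow> 'a"
  where "\<exists>i\<le>N. \<exists>j\<le>N. c i j \<noteq> 0"
    and "(\<Sum>i\<le>N. \<Sum>j\<le>N. smult (c i j) (F ^ i * H ^ j)) = 0"
proof -
  \<comment> \<open>With \<open>N = 2 * D\<close> there are 4D^2 + 4D + 1 products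
    \<open>F ^ i * H ^ j\<close>, all of degree at most 2ND = 4D^2. They outnumber the dimension
    4D^2 + 1 because \<open>D\<close> is positive, which the \<open>Suc\<close> ensures.\<close>
  define D where "D = Suc (max (degree F) (degree H))"
  define N where "N = 2 * D"
  let ?I = "{..N} \<times> {..N}"
  let ?u = "\<lambda>(i, j). F ^ i * H ^ j"
  have deg: "degree (?u x) < Suc (N * D + N * D)" if x_in: "x \<in> ?I" for x
  proof -
    obtain i j where x: "x = (i, j)" "i \<le> N" "j \<le> N"
      using x_in by auto
    have "degree (F ^ i * H ^ j) \<le> degree F * i + degree H * j"
      using degree_mult_le[of "F ^ i" "H ^ j"] degree_power_le[of F i] degree_power_le[of H j]
      by linarith
    also have "\<dots> \<le> D * N + D * N"
      using x by (intro add_mono mult_mono) (auto simp: D_def)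
    finally show ?thesis
      by (simp add: x mult.commute)
  qed
  have "Suc (N * D + N * D) < card ?I"
    by (simp add: N_def D_def card_cartesian_product algebra_simps)
  then obtain c where c: "\<exists>x\<in>?I. c x \<noteq> 0" "(\<Sum>x\<in>?I. smult (c x) (?u x)) = 0"
    using poly_family_dependent[of ?I _ ?u] deg by blast
  show ?thesis
  proof (rule that[of N "\<lambda>i j. c (i, j)"])
    show "\<exists>i\<le>N. \<exists>j\<le>N. c (i, j) \<noteq> 0"
      using c(1) by auto
    show "(\<Sum>i\<le>N. \<Sum>j\<le>N. smult (c (i, j)) (F ^ i * H ^ j)) = 0"
      using c(2) by (simp add: sum.cartesian_product case_prod_unfold)
  qed
qed

text \<open>Both polynomials are divisible by t^d, so the product is divisible by t^(d(i+j)). In a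
  relation whose terms all have \<open>k <= i + j\<close>, the coefficient at \<open>d * k\<close>
  therefore sees only the terms of total degree \<open>k\<close>.\<close>

lemma coeff_power_mult_lowest:
  fixes F H :: "'a::comm_ring_1 poly"
  assumes "\<And>i. i < d \<Longrightarrow> coeff F i = 0" "\<And>i. i < d \<Longrightarrow> coeff H i = 0" "0 < d" "k \<le> i + j"
  shows "coeff (F ^ i * H ^ j) (d * k) = (if i + j = k then coeff F d ^ i * coeff H d ^ j else 0)"
proof -
  obtain F' where F': "F = monom 1 d * F'"
    using assms(1) monom_1_dvd_iff'[of d F] by auto
  obtain H' where H': "H = monom 1 d * H'"
    using assms(2) monom_1_dvd_iff'[of d H] by auto
  have "F ^ i * H ^ j = monom 1 (d * (i + j)) * (F' ^ i * H' ^ j)"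
    by (simp add: F' H' power_mult_distrib monom_power algebra_simps mult_monom)
  then have "coeff (F ^ i * H ^ j) (d * k) =
      (if d * k < d * (i + j) then 0 else coeff (F' ^ i * H' ^ j) (d * k - d * (i + j)))"
    by (simp add: coeff_monom_mult)
  moreover have "coeff F d = coeff F' 0" "coeff H d = coeff H' 0"
    by (simp_all add: F' H' coeff_monom_mult)
  ultimately show ?thesis
    using assms(3,4) by (auto simp: coeff_mult_0 coeff_0_power)
qed

text \<open>If \<open>a\<close> and \<open>b\<close> satisfy a homogeneous equation, then \<open>b / a\<close> takes only finitely many values,
  so it is constant on every line.\<close>

lemma proportional_of_homogeneous_relation:
  assumes a: "a \<in> regular_funs n" and b: "b \<in> regular_funs n"
    and v0: "v0 \<in> carrier_vec n" "a v0 \<noteq> 0"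
    and c: "i0 \<le> N" "j0 \<le> N" "i0 + j0 = k" "c i0 j0 \<noteq> 0"
    and rel: "\<And>v. v \<in> carrier_vec n \<Longrightarrow>
      (\<Sum>i\<le>N. \<Sum>j\<le>N. if i + j = k then c i j * a v ^ i * b v ^ j else 0) = 0"
  shows "\<exists>r. \<forall>v\<in>carrier_vec n. b v = r * a v"
proof -
  \<comment> \<open>\<open>Q\<close> is the dehomogenized relation: a^k Q(b/a) is the left-hand side
    of \<open>rel\<close>.\<close>
  define Q where "Q = (\<Sum>i\<le>N. \<Sum>j\<le>N. if i + j = k then monom (c i j) j else 0)"
  \<comment> \<open>Given \<open>j0\<close>, the condition \<open>i + j0 = k\<close> leaves only
    \<open>i = i0\<close>, so no cancellation can occur in this coefficient.\<close>
  have "coeff Q j0 = (\<Sum>i\<le>N. \<Sum>j\<le>N. if i + j = k \<and> j = j0 then c i j else 0)"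
    unfolding Q_def coeff_sum by (intro sum.cong refl) auto
  also have "\<dots> = (\<Sum>i\<le>N. if i = i0 then c i0 j0 else 0)"
  proof (intro sum.cong refl)
    fix i assume "i \<in> {..N}"
    have "(\<Sum>j\<le>N. if i + j = k \<and> j = j0 then c i j else 0) =
        (\<Sum>j\<le>N. if j = j0 then (if i = i0 then c i0 j0 else 0) else 0)"
      using c by (intro sum.cong refl) auto
    then show "(\<Sum>j\<le>N. if i + j = k \<and> j = j0 then c i j else 0) = (if i = i0 then c i0 j0 else 0)"
      using c by simp
  qed
  also have "\<dots> \<noteq> 0"
    using c by simp
  finally have "Q \<noteq> 0" by auto
  then have fin: "finite {r. poly Q r = 0}"
    by (rule poly_roots_finite)
  have root: "poly Q (b v / a v) = 0" if v: "v \<in> carrier_vec n" "a v \<noteq> 0" for v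
  proof -
    have "a v ^ k * poly Q (b v / a v) =
        (\<Sum>i\<le>N. \<Sum>j\<le>N. if i + j = k then c i j * a v ^ i * b v ^ j else 0)"
      unfolding Q_def poly_sum sum_distrib_left
      using v by (intro sum.cong refl) (auto simp: poly_monom power_add power_divide)
    then show ?thesis using rel[OF v(1)] v by simp
  qed
  have "b v = (b v0 / a v0) * a v" if v: "v \<in> carrier_vec n" for v
  proof -
    define w where "w = v - v0"
    have w: "w \<in> carrier_vec n" using v v0 by (simp add: w_def)
    let ?A = "line_poly a v0 w" and ?B = "line_poly b v0 w"
    have A: "poly ?A t = a (v0 + t \<cdot>\<^sub>v w)" and B: "poly ?B t = b (v0 + t \<cdot>\<^sub>v w)" for t
      using poly_line_poly[OF a v0(1) w] poly_line_poly[OF b v0(1) w] by auto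
    \<comment> \<open>Where \<open>?A\<close> is nonzero the quotient is a root of \<open>Q\<close>
      and kills one factor; elsewhere \<open>?A\<close> itself vanishes. A product of polynomials
      that is zero has a zero factor, and \<open>?A\<close> is not it, as its value at 0 is
      \<open>a v0\<close>.\<close>
    have "poly (?A * (\<Prod>r | poly Q r = 0. ?B - smult r ?A)) t = 0" for t
    proof (cases "poly ?A t = 0")
      case False
      have "v0 + t \<cdot>\<^sub>v w \<in> carrier_vec n" using v0 w by simp
      then have "poly Q (poly ?B t / poly ?A t) = 0"
        using root False A B by simp
      moreover have "poly (?B - smult (poly ?B t / poly ?A t) ?A) t = 0"
        using False by simp
      ultimately show ?thesis
        using fin by (auto simp: poly_prod intro!: prod_zero)
    qed simp
    then have "?A * (\<Prod>r | poly Q r = 0. ?B - smult r ?A) = 0"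
      using poly_all_0_iff_0 by blast
    moreover have v0_eq: "v0 + 0 \<cdot>\<^sub>v w = v0" and v_eq: "v0 + 1 \<cdot>\<^sub>v w = v"
      using v v0 by (auto simp: w_def intro!: eq_vecI)
    moreover have "?A \<noteq> 0"
      using A[of 0] v0_eq v0(2) by auto
    ultimately obtain r where r: "?B = smult r ?A"
      using fin by (auto simp: prod_zero_iff)
    \<comment> \<open>The root \<open>r\<close> was found on one line; its value at
      \<open>t = 0\<close> identifies it as \<open>b v0 / a v0\<close>, the same for every
      \<open>v\<close>.\<close>
    have "b v0 = r * a v0" "b v = r * a v"
      using A[of 0] B[of 0] A[of 1] B[of 1] v0_eq v_eq r by auto
    then show ?thesis using v0(2) by simp
  qed
  then show ?thesis by blast
qed


section \<open>A criterion for cyclicity\<close>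

text \<open>An injective character identifies \<open>G\<close> with the full group of roots of unity of order \<open>|G|\<close>.\<close>

lemma cyclic_group_if_injective_character:
  fixes G (structure) and \<chi> :: "'a \<Rightarrow> complex"
  assumes "group G" "finite (carrier G)"
    and mult: "\<And>g h. g \<in> carrier G \<Longrightarrow> h \<in> carrier G \<Longrightarrow> \<chi> (g \<otimes> h) = \<chi> g * \<chi> h"
    and one: "\<chi> \<one> = 1"
    and inj: "\<And>g. g \<in> carrier G \<Longrightarrow> \<chi> g = 1 \<Longrightarrow> g = \<one>"
  shows "cyclic_group G"
proof -
  interpret group G by fact
  have pow: "\<chi> (g [^] k) = \<chi> g ^ k" if "g \<in> carrier G" for g and k :: nat
    using that by (induction k) (simp_all add: one mult)
  let ?N = "Coset.order G"
  have N: "?N > 0" using assms(2) order_gt_0_iff_finite by simp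
  have unity: "\<chi> g ^ ?N = 1" if "g \<in> carrier G" for g
    using pow[OF that, of ?N] pow_order_eq_1[OF that] one by simp
  have inj_on: "inj_on \<chi> (carrier G)"
  proof (rule inj_onI)
    fix g h assume gh: "g \<in> carrier G" "h \<in> carrier G" "\<chi> g = \<chi> h"
    have "\<chi> (g \<otimes> inv h) = \<chi> (h \<otimes> inv h)"
      using gh by (simp only: mult inv_closed)
    then have "g \<otimes> inv h = \<one>"
      using gh inj[of "g \<otimes> inv h"] one by simp
    then show "g = h"
      using gh inv_equality[of g "inv h"] by simp
  qed
  \<comment> \<open>An injective image of \<open>?N\<close> elements inside the \<open>?N\<close>
    roots of unity fills them, so a primitive root has a preimage, which will generate
    \<open>G\<close>.\<close>
  have surj: "\<chi> ` carrier G = {z. z ^ ?N = 1}"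
  proof (rule card_subset_eq)
    show "finite {z::complex. z ^ ?N = 1}"
      using N by (intro finite_roots_unity) simp
    show "\<chi> ` carrier G \<subseteq> {z. z ^ ?N = 1}" using unity by auto
    show "card (\<chi> ` carrier G) = card {z::complex. z ^ ?N = 1}"
      using card_roots_unity_eq[OF N] card_image[OF inj_on] by (simp add: Coset.order_def)
  qed
  have bij: "bij_betw (\<lambda>k. cis (2 * pi * real k / real ?N)) {..<?N} {z. z ^ ?N = 1}"
    using N by (rule bij_betw_roots_unity)
  have "cis (2 * pi / ?N) ^ ?N = 1"
    using N by (simp add: DeMoivre)
  then have "cis (2 * pi / ?N) \<in> \<chi> ` carrier G"
    unfolding surj by simp
  then obtain g where g: "g \<in> carrier G" "\<chi> g = cis (2 * pi / ?N)"
    by (metis imageE)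
  have "carrier G \<subseteq> range (\<lambda>k::int. g [^] k)"
  proof
    fix h assume h: "h \<in> carrier G"
    then have "\<chi> h \<in> (\<lambda>k. cis (2 * pi * real k / real ?N)) ` {..<?N}"
      unfolding bij_betw_imp_surj_on[OF bij] using unity by simp
    then obtain k where "\<chi> h = cis (2 * pi * real k / real ?N)"
      by blast
    then have "\<chi> h = \<chi> (g [^] k)"
      using pow[OF g(1)] g(2) by (simp add: DeMoivre mult_ac)
    then have "h = g [^] int k"
      using inj_on h g(1) by (simp add: inj_on_def int_pow_int)
    then show "h \<in> range (\<lambda>k::int. g [^] k)" by blast
  qed
  then show ?thesis
    using cyclic_group g(1) by auto
qed

text \<open>With \<open>k = p - q\<close> the least positive difference of elements of \<open>D\<close>, that is the gcd of \<open>D\<close>,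
  every \<open>\<chi> d\<close> is a power of \<open>\<chi> p / \<chi> q\<close>.\<close>

lemma cyclic_group_if_graded_characters:
  fixes G (structure) and \<chi> :: "nat \<Rightarrow> 'a \<Rightarrow> complex"
  assumes "group G" "finite (carrier G)"
    and D0: "0 \<in> D" and Dadd: "\<And>d e. d \<in> D \<Longrightarrow> e \<in> D \<Longrightarrow> d + e \<in> D"
    and mult: "\<And>d g h. d \<in> D \<Longrightarrow> g \<in> carrier G \<Longrightarrow> h \<in> carrier G \<Longrightarrow> \<chi> d (g \<otimes> h) = \<chi> d g * \<chi> d h"
    and one: "\<And>d. d \<in> D \<Longrightarrow> \<chi> d \<one> = 1"
    and add: "\<And>d e g. d \<in> D \<Longrightarrow> e \<in> D \<Longrightarrow> g \<in> carrier G \<Longrightarrow> \<chi> (d + e) g = \<chi> d g * \<chi> e g"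
    and faithful: "\<And>g. g \<in> carrier G \<Longrightarrow> (\<And>d. d \<in> D \<Longrightarrow> \<chi> d g = 1) \<Longrightarrow> g = \<one>"
  shows "cyclic_group G"
proof -
  interpret group G by fact
  have nz: "\<chi> d g \<noteq> 0" if "d \<in> D" "g \<in> carrier G" for d g
    using mult[OF that(1,2) inv_closed[OF that(2)]] one[OF that(1)] that(2) by auto
  have zero: "\<chi> 0 g = 1" if "g \<in> carrier G" for g
    using add[OF D0 D0 that] nz[OF D0 that] by simp
  have Dmult: "j * d \<in> D" if "d \<in> D" for j d
    using that by (induction j) (auto simp: D0 Dadd)
  have pow: "\<chi> (j * d) g = \<chi> d g ^ j" if "d \<in> D" "g \<in> carrier G" for j d g
    using that by (induction j) (auto simp: zero add Dmult)
  let ?P = "\<lambda>k. 0 < k \<and> (\<exists>q\<in>D. q + k \<in> D)"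
  show ?thesis
  proof (cases "\<exists>k. ?P k")
    case False
    \<comment> \<open>A positive member of \<open>D\<close> would itself be a positive difference,
      taken from 0. As \<open>\<chi> 0\<close> is trivial, so is the group.\<close>
    then have "D \<subseteq> {0}" using D0 by force
    then have "g = \<one>" if "g \<in> carrier G" for g
      using faithful[OF that] zero[OF that] by blast
    then show ?thesis
      by (rule cyclic_group_if_injective_character[OF assms(1,2), of "\<lambda>_. 1", rotated 2]) auto
  next
    case True
    define k where "k = (LEAST k. ?P k)"
    have "?P k" unfolding k_def using True by (rule LeastI_ex)
    then obtain q where q: "0 < k" "q \<in> D" "q + k \<in> D" by blast
    have least: "k \<le> l" if "0 < l" "x \<in> D" "x + l \<in> D" for l x
      unfolding k_def using that by (intro Least_le) auto
    have dvd: "k dvd d" if d: "d \<in> D" for d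
    proof (rule ccontr)
      assume "\<not> k dvd d"
      then have "0 < d mod k" by (simp add: dvd_eq_mod_eq_0)
      \<comment> \<open>If \<open>k\<close> did not divide \<open>d\<close>, two members of
        \<open>D\<close> would differ by the positive remainder \<open>d mod k\<close>, which is
        smaller than \<open>k\<close>.\<close>
      moreover have "(d div k) * (q + k) + d mod k = d + (d div k) * q"
        by (simp add: algebra_simps)
      then have "(d div k) * (q + k) + d mod k \<in> D"
        using d q Dadd Dmult by simp
      ultimately have "k \<le> d mod k"
        using least Dmult[OF q(3)] by blast
      then show False using mod_less_divisor[OF q(1), of d] by simp
    qed
    let ?\<psi> = "\<lambda>g. \<chi> (q + k) g / \<chi> q g"
    have \<psi>: "\<chi> d g = ?\<psi> g ^ (d div k)" if d: "d \<in> D" and g: "g \<in> carrier G" for d g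
    proof -
      let ?j = "d div k"
      \<comment> \<open>The quotient \<open>?\<psi>\<close> plays the part of a character of degree
        \<open>k\<close>, although \<open>k\<close> need not lie in \<open>D\<close>. Moving
        \<open>?j * q\<close> to the left keeps all degrees in \<open>D\<close>.\<close>
      have "d + ?j * q = ?j * (q + k)"
        using dvd[OF d] by (simp add: algebra_simps)
      then have "\<chi> d g * \<chi> q g ^ ?j = \<chi> (q + k) g ^ ?j"
        using add[OF d Dmult[OF q(2)] g, of ?j] pow[OF q(2) g, of ?j] pow[OF q(3) g, of ?j] by simp
      then show ?thesis
        using nz[OF q(2) g] by (simp add: power_divide field_simps)
    qed
    show ?thesis
    proof (rule cyclic_group_if_injective_character[OF assms(1,2), of ?\<psi>])
      show "g = \<one>" if "g \<in> carrier G" "?\<psi> g = 1" for g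
        using that by (intro faithful) (simp_all add: \<psi>)
    qed (use q in \<open>simp_all add: mult one\<close>)
  qed
qed


section \<open>Leading forms of functions pulled back from the image\<close>

text \<open>Up to values off \<open>carrier_vec n\<close>, this is the coordinate ring of the
  closure of the image.\<close>

definition pullbacks ::
  "nat \<Rightarrow> nat \<Rightarrow> (complex vec \<Rightarrow> complex vec) \<Rightarrow> (complex vec \<Rightarrow> complex) set" where
  "pullbacks n m \<phi> = {f. \<exists>p\<in>regular_funs m. \<forall>v\<in>carrier_vec n. f v = p (\<phi> v)}"

text \<open>Leading means lowest here. Requiring \<open>a\<close> to be nonzero forces
  \<open>d\<close> to be the order of vanishing of \<open>f\<close> at the origin.\<close>

definition leading_form ::
  "nat \<Rightarrow> (complex vec \<Rightarrow> complex) set \<Rightarrow> nat \<Rightarrow> (complex vec \<Rightarrow> complex) \<Rightarrow> bool" where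
  "leading_form n A d a \<longleftrightarrow>
     (\<exists>f\<in>A. \<forall>v\<in>carrier_vec n. (\<forall>i<d. hom_comp n f i v = 0) \<and> hom_comp n f d v = a v) \<and>
     (\<exists>v\<in>carrier_vec n. a v \<noteq> 0)"

lemma pullbacks_regular:
  assumes "poly_map n m \<phi>" "f \<in> pullbacks n m \<phi>"
  shows "f \<in> regular_funs n"
proof -
  obtain p where "p \<in> regular_funs m" "\<forall>v\<in>carrier_vec n. f v = p (\<phi> v)"
    using assms(2) unfolding pullbacks_def by blast
  then show ?thesis
    using regular_funs_cong[OF regular_funs_compose[OF _ assms(1)], of p f] by simp
qed

lemma pullbacks_mult:
  assumes "f \<in> pullbacks n m \<phi>" "h \<in> pullbacks n m \<phi>"
  shows "(\<lambda>v. f v * h v) \<in> pullbacks n m \<phi>"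
proof -
  obtain p q where "p \<in> regular_funs m" "\<forall>v\<in>carrier_vec n. f v = p (\<phi> v)"
    "q \<in> regular_funs m" "\<forall>v\<in>carrier_vec n. h v = q (\<phi> v)"
    using assms unfolding pullbacks_def by blast
  then show ?thesis
    unfolding pullbacks_def using regular_funs_mult[of p m q] by auto
qed

lemma pullbacks_diff:
  assumes "f \<in> pullbacks n m \<phi>" "h \<in> pullbacks n m \<phi>"
  shows "(\<lambda>v. f v - h v) \<in> pullbacks n m \<phi>"
proof -
  obtain p q where "p \<in> regular_funs m" "\<forall>v\<in>carrier_vec n. f v = p (\<phi> v)"
    "q \<in> regular_funs m" "\<forall>v\<in>carrier_vec n. h v = q (\<phi> v)"
    using assms unfolding pullbacks_def by blast
  then show ?thesis
    unfolding pullbacks_def using regular_funs_diff[of p m q] by auto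
qed

lemma leading_form_one: "leading_form n (pullbacks n m \<phi>) 0 (\<lambda>v. 1)"
proof -
  have "hom_comp n (\<lambda>v. 1) 0 v = 1" if "v \<in> carrier_vec n" for v
    unfolding hom_comp_def using that by (subst ray_poly_eqI[of _ _ "[:1:]"]) auto
  moreover have "(\<lambda>v. 1) \<in> pullbacks n m \<phi>"
    unfolding pullbacks_def by (auto intro!: bexI[of _ "\<lambda>v. 1"])
  moreover have "\<exists>v. v \<in> (carrier_vec n :: complex vec set)"
    using zero_carrier_vec by blast
  ultimately show ?thesis
    unfolding leading_form_def by (auto intro!: bexI[of _ "\<lambda>v. 1"])
qed

lemma leading_form_regular:
  assumes "poly_map n m \<phi>" "leading_form n (pullbacks n m \<phi>) d a"
  shows "a \<in> regular_funs n"
proof -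
  obtain f where "f \<in> pullbacks n m \<phi>" "\<forall>v\<in>carrier_vec n. hom_comp n f d v = a v"
    using assms(2) unfolding leading_form_def by blast
  then show ?thesis
    using regular_funs_cong[OF hom_comp_regular[OF pullbacks_regular[OF assms(1)]], of f a d] by simp
qed

text \<open>Orders of vanishing add and lowest coefficients multiply. The product is nonzero
  because, on a line through a nonzero of \<open>a\<close> and a nonzero of \<open>b\<close>, both
  restrict to nonzero polynomials.\<close>

lemma leading_form_mult:
  assumes \<phi>: "poly_map n m \<phi>"
    and "leading_form n (pullbacks n m \<phi>) d a" "leading_form n (pullbacks n m \<phi>) e b"
  shows "leading_form n (pullbacks n m \<phi>) (d + e) (\<lambda>v. a v * b v)"
proof -
  obtain f where f: "f \<in> pullbacks n m \<phi>"
    "\<And>v i. v \<in> carrier_vec n \<Longrightarrow> i < d \<Longrightarrow> hom_comp n f i v = 0"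
    "\<And>v. v \<in> carrier_vec n \<Longrightarrow> hom_comp n f d v = a v"
    using assms(2) unfolding leading_form_def by blast
  obtain h where h: "h \<in> pullbacks n m \<phi>"
    "\<And>v i. v \<in> carrier_vec n \<Longrightarrow> i < e \<Longrightarrow> hom_comp n h i v = 0"
    "\<And>v. v \<in> carrier_vec n \<Longrightarrow> hom_comp n h e v = b v"
    using assms(3) unfolding leading_form_def by blast
  obtain v w where v: "v \<in> carrier_vec n" "a v \<noteq> 0" and w: "w \<in> carrier_vec n" "b w \<noteq> 0"
    using assms(2,3) unfolding leading_form_def by blast
  have reg: "a \<in> regular_funs n" "b \<in> regular_funs n"
    using leading_form_regular[OF \<phi>] assms by blast+
  have wv: "w - v \<in> carrier_vec n" using v w by simp
  have A: "poly (line_poly a v (w - v)) t = a (v + t \<cdot>\<^sub>v (w - v))"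
    and B: "poly (line_poly b v (w - v)) t = b (v + t \<cdot>\<^sub>v (w - v))" for t
    using poly_line_poly[OF reg(1) v(1) wv] poly_line_poly[OF reg(2) v(1) wv] by auto
  have "v + 0 \<cdot>\<^sub>v (w - v) = v" "v + 1 \<cdot>\<^sub>v (w - v) = w"
    using v w by (auto intro!: eq_vecI)
  then have "poly (line_poly a v (w - v)) 0 \<noteq> 0" "poly (line_poly b v (w - v)) 1 \<noteq> 0"
    using A B v w by auto
  then obtain t where "poly (line_poly a v (w - v)) t \<noteq> 0" "poly (line_poly b v (w - v)) t \<noteq> 0"
    using poly_common_nonroot by blast
  then have "\<exists>x\<in>carrier_vec n. a x * b x \<noteq> 0"
    using A B v wv by (intro bexI[of _ "v + t \<cdot>\<^sub>v (w - v)"]) auto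
  moreover have "(\<forall>i<d + e. hom_comp n (\<lambda>v. f v * h v) i x = 0) \<and>
      hom_comp n (\<lambda>v. f v * h v) (d + e) x = a x * b x" if x: "x \<in> carrier_vec n" for x
  proof -
    obtain F where F: "ray_poly n f x = monom 1 d * F"
      using f(2)[OF x] monom_1_dvd_iff'[of d "ray_poly n f x"] by (auto simp: hom_comp_def)
    obtain H where H: "ray_poly n h x = monom 1 e * H"
      using h(2)[OF x] monom_1_dvd_iff'[of e "ray_poly n h x"] by (auto simp: hom_comp_def)
    have monom_add: "monom 1 (d + e) = monom 1 d * monom (1 :: complex) e"
      by (simp add: mult_monom)
    have "ray_poly n (\<lambda>v. f v * h v) x = monom 1 (d + e) * (F * H)"
      unfolding monom_add using ray_poly_mult[OF pullbacks_regular[OF \<phi> f(1)] pullbacks_regular[OF \<phi> h(1)] x]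
      by (simp only: F H mult_ac)
    moreover have "a x = coeff F 0" "b x = coeff H 0"
      using f(3)[OF x] h(3)[OF x] by (simp_all add: hom_comp_def F H coeff_monom_mult)
    ultimately show ?thesis
      by (simp add: hom_comp_def coeff_monom_mult coeff_mult_0)
  qed
  ultimately show ?thesis
    unfolding leading_form_def using pullbacks_mult[OF f(1) h(1)]
    by (intro conjI bexI[of _ "\<lambda>v. f v * h v"]) auto
qed

lemma leading_form_exists:
  assumes "poly_map n m \<phi>" "f \<in> pullbacks n m \<phi>" "v \<in> carrier_vec n" "f v \<noteq> 0"
  obtains d where "leading_form n (pullbacks n m \<phi>) d (hom_comp n f d)"
proof -
  let ?P = "\<lambda>d. \<exists>v\<in>carrier_vec n. hom_comp n f d v \<noteq> 0"
  have "poly (ray_poly n f v) 1 \<noteq> 0"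
    using poly_ray_poly[OF pullbacks_regular[OF assms(1,2)] assms(3), of 1] assms(3,4) by simp
  then have "ray_poly n f v \<noteq> 0" by auto
  then have "\<exists>d. ?P d"
    using assms(3) unfolding hom_comp_def by (auto simp: poly_eq_iff)
  then have "?P (LEAST d. ?P d)" by (rule LeastI_ex)
  moreover have "\<not> ?P i" if "i < (LEAST d. ?P d)" for i
    using that by (rule not_less_Least)
  ultimately have "leading_form n (pullbacks n m \<phi>) (LEAST d. ?P d) (hom_comp n f (LEAST d. ?P d))"
    unfolding leading_form_def using assms(2) by blast
  then show ?thesis using that by blast
qed

text \<open>Two pulled back functions are algebraically dependent along a line through the origin, hence
  everywhere. The lowest homogeneous part of such a relation is a relation between leading forms.\<close>

lemma leading_form_proportional:
  assumes \<phi>: "poly_map n m \<phi>" and dim: "map_dim n m \<phi> = 1"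
    and a: "leading_form n (pullbacks n m \<phi>) d a" and b: "leading_form n (pullbacks n m \<phi>) d b"
  shows "\<exists>r. \<forall>v\<in>carrier_vec n. b v = r * a v"
proof -
  obtain f where f: "f \<in> pullbacks n m \<phi>"
    "\<And>v i. v \<in> carrier_vec n \<Longrightarrow> i < d \<Longrightarrow> hom_comp n f i v = 0"
    "\<And>v. v \<in> carrier_vec n \<Longrightarrow> hom_comp n f d v = a v"
    using a unfolding leading_form_def by blast
  obtain h where h: "h \<in> pullbacks n m \<phi>"
    "\<And>v i. v \<in> carrier_vec n \<Longrightarrow> i < d \<Longrightarrow> hom_comp n h i v = 0"
    "\<And>v. v \<in> carrier_vec n \<Longrightarrow> hom_comp n h d v = b v"
    using b unfolding leading_form_def by blast
  obtain v0 where v0: "v0 \<in> carrier_vec n" "a v0 \<noteq> 0"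
    using a unfolding leading_form_def by blast
  note f_reg = pullbacks_regular[OF \<phi> f(1)] and h_reg = pullbacks_regular[OF \<phi> h(1)]
  show ?thesis
  proof (cases "d = 0")
    \<comment> \<open>Lowest forms of degree 0 are the constants \<open>f 0\<close> and
      \<open>h 0\<close>. Positive \<open>d\<close> is what the coefficient comparison below relies
      on.\<close>
    case True
    have zero: "0 \<cdot>\<^sub>v v = 0\<^sub>v n" if "v \<in> carrier_vec n" for v :: "complex vec"
      using that by (intro eq_vecI) auto
    have "a v = f (0\<^sub>v n)" if v: "v \<in> carrier_vec n" for v
      using f(3)[OF v] poly_ray_poly[OF f_reg v, of 0]
      unfolding True hom_comp_def zero[OF v] poly_0_coeff_0 by simp
    moreover have "b v = h (0\<^sub>v n)" if v: "v \<in> carrier_vec n" for v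
      using h(3)[OF v] poly_ray_poly[OF h_reg v, of 0]
      unfolding True hom_comp_def zero[OF v] poly_0_coeff_0 by simp
    ultimately have "\<forall>v\<in>carrier_vec n. b v = b v0 / a v0 * a v"
      using v0 by simp
    then show ?thesis by blast
  next
    case False
    obtain p where p: "p \<in> regular_funs m" "\<And>v. v \<in> carrier_vec n \<Longrightarrow> f v = p (\<phi> v)"
      using f(1) unfolding pullbacks_def by blast
    obtain q where q: "q \<in> regular_funs m" "\<And>v. v \<in> carrier_vec n \<Longrightarrow> h v = q (\<phi> v)"
      using h(1) unfolding pullbacks_def by blast
    \<comment> \<open>Were \<open>f\<close> constant on the ray through \<open>v0\<close>, its
      component of positive degree \<open>d\<close> would vanish at \<open>v0\<close>, against
      \<open>a v0\<close> being nonzero.\<close>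
    have "\<exists>t. p (\<phi> (t \<cdot>\<^sub>v v0)) \<noteq> p (\<phi> (0\<^sub>v n))"
    proof (rule ccontr)
      assume "\<not> ?thesis"
      then have "f (t \<cdot>\<^sub>v v0) = p (\<phi> (0\<^sub>v n))" for t
        using p(2)[of "t \<cdot>\<^sub>v v0"] v0(1) by simp
      then have "ray_poly n f v0 = [:p (\<phi> (0\<^sub>v n)):]"
        by (intro ray_poly_eqI[OF v0(1)]) simp
      then have "a v0 = 0"
        using f(3)[OF v0(1)] False by (simp add: hom_comp_def coeff_pCons split: nat.splits)
      then show False using v0(2) by simp
    qed
    then obtain t where t: "p (\<phi> (t \<cdot>\<^sub>v v0)) \<noteq> p (\<phi> (0\<^sub>v n))" by blast
    \<comment> \<open>The coefficients come from the single ray through \<open>v0\<close>;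
      \<open>rel\<close> shows that the same ones work on every ray.\<close>
    obtain N c where c: "\<exists>i\<le>N. \<exists>j\<le>N. c i j \<noteq> 0"
      and rel0: "(\<Sum>i\<le>N. \<Sum>j\<le>N. smult (c i j) (ray_poly n f v0 ^ i * ray_poly n h v0 ^ j)) = 0"
      by (rule poly_algebraically_dependent)
    have eval: "poly (\<Sum>i\<le>N. \<Sum>j\<le>N. smult (c i j) (ray_poly n f v ^ i * ray_poly n h v ^ j)) s =
        (\<Sum>i\<le>N. \<Sum>j\<le>N. c i j * (p (\<phi> (s \<cdot>\<^sub>v v)) ^ i * q (\<phi> (s \<cdot>\<^sub>v v)) ^ j))"
      if "v \<in> carrier_vec n" for v s
      using that
      by (simp add: poly_sum poly_ray_poly[OF f_reg] poly_ray_poly[OF h_reg] p(2) q(2))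
    have rel: "(\<Sum>i\<le>N. \<Sum>j\<le>N. smult (c i j) (ray_poly n f v ^ i * ray_poly n h v ^ j)) = 0"
      if v: "v \<in> carrier_vec n" for v
    proof -
      \<comment> \<open>As a function on the target space, the relation vanishes on the image of a
        ray that is not contracted, hence on the whole image since the dimension is 1.\<close>
      let ?R = "\<lambda>x. \<Sum>i\<le>N. \<Sum>j\<le>N. c i j * (p x ^ i * q x ^ j)"
      have R: "?R \<in> regular_funs m"
        by (intro regular_funs_sum regular_funs_mult regular_funs_power regular_funs_const p(1) q(1))
      have "?R (\<phi> (s \<cdot>\<^sub>v v0)) = 0" for s
        using eval[OF v0(1), of s] rel0 by simp
      then have "?R (\<phi> (s \<cdot>\<^sub>v v)) = 0" for s
        by (rule vanish_on_ray_imp_vanish[OF \<phi> dim R p(1) v0(1) t]) (use v in simp)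
      then have "\<forall>s. poly (\<Sum>i\<le>N. \<Sum>j\<le>N. smult (c i j) (ray_poly n f v ^ i * ray_poly n h v ^ j)) s = 0"
        unfolding eval[OF v] by blast
      then show ?thesis
        by (simp only: poly_all_0_iff_0)
    qed
    let ?P = "\<lambda>k. \<exists>i\<le>N. \<exists>j\<le>N. c i j \<noteq> 0 \<and> i + j = k"
    \<comment> \<open>The lowest total degree in the relation: its coefficient at
      \<open>d * k\<close> is a homogeneous relation of degree \<open>k\<close> between
      \<open>a\<close> and \<open>b\<close>.\<close>
    define k where "k = (LEAST k. ?P k)"
    have "?P k"
      unfolding k_def by (rule LeastI_ex) (use c in blast)
    then obtain i0 j0 where ij0: "i0 \<le> N" "j0 \<le> N" "i0 + j0 = k" "c i0 j0 \<noteq> 0" by blast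
    have least: "k \<le> i + j" if "i \<le> N" "j \<le> N" "c i j \<noteq> 0" for i j
      unfolding k_def by (rule Least_le) (use that in blast)
    show ?thesis
    proof (rule proportional_of_homogeneous_relation[of a n b v0 i0 N j0 k c, OF _ _ v0 ij0])
      show "a \<in> regular_funs n" "b \<in> regular_funs n"
        using leading_form_regular[OF \<phi>] a b by blast+
      fix v :: "complex vec"
      assume v: "v \<in> carrier_vec n"
      have "(if i + j = k then c i j * a v ^ i * b v ^ j else 0) =
          coeff (smult (c i j) (ray_poly n f v ^ i * ray_poly n h v ^ j)) (d * k)"
        if "i \<le> N" "j \<le> N" for i j
      proof (cases "c i j = 0")
        case nz: False
        have "coeff (ray_poly n f v ^ i * ray_poly n h v ^ j) (d * k) =
            (if i + j = k then a v ^ i * b v ^ j else 0)"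
          using coeff_power_mult_lowest[of d "ray_poly n f v" "ray_poly n h v" k i j]
            f(2)[OF v] h(2)[OF v] False least[OF that nz] unfolding f(3)[OF v, symmetric] h(3)[OF v, symmetric]
          by (simp add: hom_comp_def)
        then show ?thesis by simp
      qed simp
      then have "(\<Sum>i\<le>N. \<Sum>j\<le>N. if i + j = k then c i j * a v ^ i * b v ^ j else 0) =
          coeff (\<Sum>i\<le>N. \<Sum>j\<le>N. smult (c i j) (ray_poly n f v ^ i * ray_poly n h v ^ j)) (d * k)"
        unfolding coeff_sum by (intro sum.cong refl) auto
      then show "(\<Sum>i\<le>N. \<Sum>j\<le>N. if i + j = k then c i j * a v ^ i * b v ^ j else 0) = 0"
        using rel[OF v] by simp
    qed
  qed
qed


section \<open>The action on leading forms\<close>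

lemma G_module_carrier:
  assumes "G_module G n \<rho>" "g \<in> carrier G"
  shows "\<rho> g \<in> carrier_mat n n"
  using assms unfolding G_module_def by auto

lemma G_module_mult_vec:
  assumes "G_module G n \<rho>" "g \<in> carrier G" "h \<in> carrier G" "v \<in> carrier_vec n"
  shows "\<rho> (g \<otimes>\<^bsub>G\<^esub> h) *\<^sub>v v = \<rho> g *\<^sub>v (\<rho> h *\<^sub>v v)"
  using assms G_module_carrier[OF assms(1)] unfolding G_module_def
  by (auto intro!: assoc_mult_mat_vec)

lemma G_module_one_vec:
  assumes "G_module G n \<rho>" "v \<in> carrier_vec n"
  shows "\<rho> \<one>\<^bsub>G\<^esub> *\<^sub>v v = v"
  using assms unfolding G_module_def by simp

text \<open>Linear substitutions map rays to rays with the same parameter, M(tv) = t(Mv), so they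
  preserve degrees.\<close>

lemma hom_comp_mult_mat_vec:
  assumes "f \<in> regular_funs n" "M \<in> carrier_mat n n" "v \<in> carrier_vec n"
  shows "hom_comp n (\<lambda>v. f (M *\<^sub>v v)) d v = hom_comp n f d (M *\<^sub>v v)"
proof -
  have "ray_poly n (\<lambda>v. f (M *\<^sub>v v)) v = ray_poly n f (M *\<^sub>v v)"
    using assms by (intro ray_poly_eqI) (simp_all add: poly_ray_poly mult_mat_vec)
  then show ?thesis by (simp add: hom_comp_def)
qed

text \<open>By equivariance, substituting \<open>\<rho> g\<close> in the source amounts to
  substituting \<open>\<sigma> g\<close> in the target.\<close>

lemma pullbacks_action:
  assumes cov: "covariant G n \<rho> m \<sigma> \<phi>" and f: "f \<in> pullbacks n m \<phi>" and g: "g \<in> carrier G"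
  shows "(\<lambda>v. f (\<rho> g *\<^sub>v v)) \<in> pullbacks n m \<phi>"
proof -
  have mods: "G_module G n \<rho>" "G_module G m \<sigma>"
    and eq: "\<And>v. v \<in> carrier_vec n \<Longrightarrow> \<phi> (\<rho> g *\<^sub>v v) = \<sigma> g *\<^sub>v \<phi> v"
    using cov g unfolding covariant_def by auto
  obtain p where p: "p \<in> regular_funs m" "\<And>v. v \<in> carrier_vec n \<Longrightarrow> f v = p (\<phi> v)"
    using f unfolding pullbacks_def by blast
  have "(\<lambda>w. p (\<sigma> g *\<^sub>v w)) \<in> regular_funs m"
    by (rule regular_funs_compose[OF p(1) poly_map_mult_mat_vec[OF G_module_carrier[OF mods(2) g]]])
  moreover have "f (\<rho> g *\<^sub>v v) = p (\<sigma> g *\<^sub>v \<phi> v)" if "v \<in> carrier_vec n" for v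
    using p(2)[of "\<rho> g *\<^sub>v v"] G_module_carrier[OF mods(1) g] eq that by simp
  ultimately show ?thesis
    unfolding pullbacks_def by auto
qed

text \<open>Pullbacks are stable under the action and degrees are preserved; the form stays nonzero
  because \<open>\<rho> g\<close> is invertible.\<close>

lemma leading_form_action:
  assumes cov: "covariant G n \<rho> m \<sigma> \<phi>" and G: "group G" and g: "g \<in> carrier G"
    and a: "leading_form n (pullbacks n m \<phi>) d a"
  shows "leading_form n (pullbacks n m \<phi>) d (\<lambda>v. a (\<rho> g *\<^sub>v v))"
proof -
  interpret group G by fact
  have mod: "G_module G n \<rho>" and \<phi>: "poly_map n m \<phi>"
    using cov unfolding covariant_def by auto
  note \<rho> = G_module_carrier[OF mod]
  obtain f where f: "f \<in> pullbacks n m \<phi>"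
    "\<And>v i. v \<in> carrier_vec n \<Longrightarrow> i < d \<Longrightarrow> hom_comp n f i v = 0"
    "\<And>v. v \<in> carrier_vec n \<Longrightarrow> hom_comp n f d v = a v"
    using a unfolding leading_form_def by blast
  obtain v where v: "v \<in> carrier_vec n" "a v \<noteq> 0"
    using a unfolding leading_form_def by blast
  have "\<rho> g *\<^sub>v (\<rho> (inv\<^bsub>G\<^esub> g) *\<^sub>v v) = v"
    using G_module_mult_vec[OF mod g inv_closed[OF g] v(1)] G_module_one_vec[OF mod v(1)] g by simp
  then have "\<exists>v\<in>carrier_vec n. a (\<rho> g *\<^sub>v v) \<noteq> 0"
    using v \<rho>[OF inv_closed[OF g]] by (intro bexI[of _ "\<rho> (inv\<^bsub>G\<^esub> g) *\<^sub>v v"]) auto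
  moreover have "hom_comp n (\<lambda>v. f (\<rho> g *\<^sub>v v)) i v = hom_comp n f i (\<rho> g *\<^sub>v v)"
    if "v \<in> carrier_vec n" for v i
    by (rule hom_comp_mult_mat_vec[OF pullbacks_regular[OF \<phi> f(1)] \<rho>[OF g] that])
  ultimately show ?thesis
    unfolding leading_form_def using pullbacks_action[OF cov f(1) g] f(2,3) \<rho>[OF g]
    by (intro conjI bexI[of _ "\<lambda>v. f (\<rho> g *\<^sub>v v)"]) auto
qed

text \<open>For \<open>f\<close> with \<open>f \<circ> g \<noteq> f\<close>, take the leading form of \<open>u = f \<circ> g - f\<close>. If \<open>g\<close> fixed it, then
  \<open>0 = f \<circ> g ^ N - f = (\<Sum>j<N. u \<circ> g ^ j)\<close>, with \<open>N\<close> the order of \<open>G\<close>, would have \<open>N\<close> times it as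
  its leading form.\<close>

lemma leading_form_not_fixed:
  assumes cov: "faithful_covariant G n \<rho> m \<sigma> \<phi>" and G: "group G" "finite (carrier G)"
    and g: "g \<in> carrier G" "g \<noteq> \<one>\<^bsub>G\<^esub>"
  shows "\<exists>d a. leading_form n (pullbacks n m \<phi>) d a \<and> (\<exists>v\<in>carrier_vec n. a (\<rho> g *\<^sub>v v) \<noteq> a v)"
proof (rule ccontr)
  assume fixed: "\<not> ?thesis"
  interpret group G by fact
  have cov': "covariant G n \<rho> m \<sigma> \<phi>"
    using cov unfolding faithful_covariant_def by blast
  then have mod: "G_module G n \<rho>" and \<phi>: "poly_map n m \<phi>"
    and eq: "\<And>v. v \<in> carrier_vec n \<Longrightarrow> \<phi> (\<rho> g *\<^sub>v v) = \<sigma> g *\<^sub>v \<phi> v"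
    using g unfolding covariant_def by auto
  note \<rho> = G_module_carrier[OF mod]
  have \<phi>c: "\<phi> v \<in> carrier_vec m" if "v \<in> carrier_vec n" for v
    using \<phi> that unfolding poly_map_def by auto
  obtain w where w: "w \<in> carrier_vec n" "\<phi> (\<rho> g *\<^sub>v w) \<noteq> \<phi> w"
  proof -
    have "\<exists>w\<in>carrier_vec n. \<sigma> g *\<^sub>v \<phi> w \<noteq> \<phi> w"
      using cov g unfolding faithful_covariant_def by blast
    then show thesis using eq that by auto
  qed
  have gw: "\<rho> g *\<^sub>v w \<in> carrier_vec n" using \<rho>[OF g(1)] w(1) by auto
  then obtain i where i: "i < m" "\<phi> (\<rho> g *\<^sub>v w) $ i \<noteq> \<phi> w $ i"
    using w \<phi>c by (metis carrier_vecD eq_vecI)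
  \<comment> \<open>Faithfulness gives a point whose image is moved by \<open>g\<close>, and some
    coordinate detects this.\<close>
  define f where "f = (\<lambda>v. \<phi> v $ i)"
  have f: "f \<in> pullbacks n m \<phi>"
    unfolding pullbacks_def f_def using regular_funs_coord[OF i(1)] by auto
  define u where "u = (\<lambda>v. f (\<rho> g *\<^sub>v v) - f v)"
  have u: "u \<in> pullbacks n m \<phi>"
    unfolding u_def by (intro pullbacks_diff pullbacks_action[OF cov'] f g)
  have "u w \<noteq> 0" using i by (simp add: u_def f_def)
  from leading_form_exists[OF \<phi> u w(1) this] obtain d
    where d: "leading_form n (pullbacks n m \<phi>) d (hom_comp n u d)" by blast
  then obtain v where v: "v \<in> carrier_vec n" "hom_comp n u d v \<noteq> 0"
    unfolding leading_form_def by blast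
  \<comment> \<open>The orbit of \<open>v\<close> under the powers of \<open>g\<close>; it returns
    to \<open>v\<close> after \<open>?N\<close> steps.\<close>
  define x where "x = (\<lambda>j::nat. \<rho> (g [^]\<^bsub>G\<^esub> j) *\<^sub>v v)"
  let ?N = "Coset.order G"
  have x_carrier: "x j \<in> carrier_vec n" for j
    unfolding x_def using \<rho>[OF nat_pow_closed[OF g(1), of j]] v(1) by auto
  have x0: "x 0 = v"
    unfolding x_def using G_module_one_vec[OF mod v(1)] by simp
  have xN: "x ?N = v"
    unfolding x_def using pow_order_eq_1[OF g(1)] G_module_one_vec[OF mod v(1)] by simp
  have xSuc: "x (Suc j) = \<rho> g *\<^sub>v x j" for j
    unfolding x_def using G_module_mult_vec[OF mod g(1) nat_pow_closed[OF g(1), of j] v(1)] nat_pow_Suc2[OF g(1)]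
    by simp
  \<comment> \<open>By assumption \<open>g\<close> fixes the leading form of \<open>u\<close>, so it
    is constant along the orbit.\<close>
  have comp: "hom_comp n u d (x j) = hom_comp n u d v" for j
  proof (induction j)
    case (Suc j)
    have "hom_comp n u d (\<rho> g *\<^sub>v x j) = hom_comp n u d (x j)"
      using fixed d x_carrier by blast
    then show ?case using Suc xSuc by simp
  qed (simp add: x0)
  have "poly (\<Sum>j<?N. ray_poly n u (x j)) t = 0" for t
  proof -
    \<comment> \<open>Each value of \<open>u\<close> is the increment of \<open>f\<close> between
      consecutive points of the scaled orbit, so the sum telescopes around a closed cycle.\<close>
    have "u (t \<cdot>\<^sub>v x j) = f (t \<cdot>\<^sub>v x (Suc j)) - f (t \<cdot>\<^sub>v x j)" for j
      unfolding u_def xSuc using mult_mat_vec[OF \<rho>[OF g(1)] x_carrier] by simp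
    then have "(\<Sum>j<?N. u (t \<cdot>\<^sub>v x j)) = f (t \<cdot>\<^sub>v x ?N) - f (t \<cdot>\<^sub>v x 0)"
      using sum_lessThan_telescope[of "\<lambda>j. f (t \<cdot>\<^sub>v x j)" ?N] by simp
    also have "\<dots> = 0"
      unfolding x0 xN by simp
    finally show ?thesis
      using poly_ray_poly[OF pullbacks_regular[OF \<phi> u] x_carrier] by (simp add: poly_sum)
  qed
  then have "(\<Sum>j<?N. ray_poly n u (x j)) = 0"
    using poly_all_0_iff_0 by blast
  then have "(\<Sum>j<?N. hom_comp n u d (x j)) = 0"
    unfolding hom_comp_def by (metis coeff_0 coeff_sum)
  then have "of_nat ?N * hom_comp n u d v = 0"
    unfolding comp by simp
  moreover have "?N > 0"
    using G(2) order_gt_0_iff_finite by blast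
  ultimately show False using v(2) by simp
qed

theorem theorem10p1:
  fixes G :: "'a monoid"
  assumes "group G"
    and "finite (carrier G)"
    and "covdim G = 1"
  shows "cyclic_group G"
proof -
  define M where "M = {map_dim n m \<phi> | n \<rho> m \<sigma> \<phi>. faithful_covariant G n \<rho> m \<sigma> \<phi>}"
  have inf: "Inf M = 1"
    using assms(3) unfolding covdim_def M_def .
  \<comment> \<open>An empty infimum would be infinite; a nonempty one is attained by well-ordering,
    which yields a covariant of dimension exactly 1.\<close>
  then have "M \<noteq> {}"
    by (auto simp: top_enat_def one_enat_def)
  then obtain x where "x \<in> M" by blast
  then have "1 \<in> M"
    using wellorder_InfI[of x M] inf by simp
  then obtain n \<rho> m \<sigma> \<phi> where cov: "faithful_covariant G n \<rho> m \<sigma> \<phi>" and dim: "map_dim n m \<phi> = 1"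
    unfolding M_def by auto
  interpret group G by fact
  have cov': "covariant G n \<rho> m \<sigma> \<phi>"
    using cov unfolding faithful_covariant_def by blast
  then have mod: "G_module G n \<rho>" and \<phi>: "poly_map n m \<phi>"
    unfolding covariant_def by auto
  note \<rho> = G_module_carrier[OF mod]
  let ?L = "leading_form n (pullbacks n m \<phi>)"
  define D where "D = {d. \<exists>a. ?L d a}"
  \<comment> \<open>The scalar is read off from one form of degree \<open>d\<close>; all others of
    that degree are multiples of it, so it does not depend on the choice.\<close>
  have "\<exists>r. \<forall>a. ?L d a \<longrightarrow> (\<forall>v\<in>carrier_vec n. a (\<rho> g *\<^sub>v v) = r * a v)"
    if d: "d \<in> D" and g: "g \<in> carrier G" for d g
  proof -
    obtain a where a: "?L d a" using d unfolding D_def by blast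
    obtain r where r: "\<forall>v\<in>carrier_vec n. a (\<rho> g *\<^sub>v v) = r * a v"
      using leading_form_proportional[OF \<phi> dim a leading_form_action[OF cov' assms(1) g a]] by blast
    have "b (\<rho> g *\<^sub>v v) = r * b v" if b: "?L d b" and v: "v \<in> carrier_vec n" for b v
    proof -
      obtain s where s: "\<forall>v\<in>carrier_vec n. b v = s * a v"
        using leading_form_proportional[OF \<phi> dim a b] by blast
      then show ?thesis using r v \<rho>[OF g] by simp
    qed
    then show ?thesis by blast
  qed
  then obtain \<chi> where \<chi>: "\<And>d g a v. d \<in> D \<Longrightarrow> g \<in> carrier G \<Longrightarrow> ?L d a \<Longrightarrow>
      v \<in> carrier_vec n \<Longrightarrow> a (\<rho> g *\<^sub>v v) = \<chi> d g * a v"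
    by metis
  have witness: "\<exists>a v. ?L d a \<and> v \<in> carrier_vec n \<and> a v \<noteq> 0" if "d \<in> D" for d
    using that unfolding D_def leading_form_def by blast
  show ?thesis
  proof (rule cyclic_group_if_graded_characters[OF assms(1,2)])
    show "0 \<in> D"
      unfolding D_def using leading_form_one by blast
    show "d + e \<in> D" if "d \<in> D" "e \<in> D" for d e
      using that leading_form_mult[OF \<phi>] unfolding D_def by blast
    show "\<chi> d (g \<otimes>\<^bsub>G\<^esub> h) = \<chi> d g * \<chi> d h"
      if d: "d \<in> D" and g: "g \<in> carrier G" and h: "h \<in> carrier G" for d g h
    proof -
      obtain a v where a: "?L d a" "v \<in> carrier_vec n" "a v \<noteq> 0"
        using witness[OF d] by blast
      have "\<chi> d (g \<otimes>\<^bsub>G\<^esub> h) * a v = a (\<rho> g *\<^sub>v (\<rho> h *\<^sub>v v))"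
        using \<chi>[OF d m_closed[OF g h] a(1,2)] G_module_mult_vec[OF mod g h a(2)] by simp
      also have "\<dots> = \<chi> d g * (\<chi> d h * a v)"
        using \<chi>[OF d g a(1), of "\<rho> h *\<^sub>v v"] \<chi>[OF d h a(1,2)] \<rho>[OF h] a(2) by simp
      finally show ?thesis using a(3) by simp
    qed
    show "\<chi> d \<one>\<^bsub>G\<^esub> = 1" if d: "d \<in> D" for d
    proof -
      obtain a v where a: "?L d a" "v \<in> carrier_vec n" "a v \<noteq> 0"
        using witness[OF d] by blast
      then show ?thesis
        using \<chi>[OF d one_closed a(1,2)] G_module_one_vec[OF mod a(2)] by simp
    qed
    show "\<chi> (d + e) g = \<chi> d g * \<chi> e g" if d: "d \<in> D" and e: "e \<in> D" and g: "g \<in> carrier G" for d e g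
    proof -
      obtain a b where a: "?L d a" and b: "?L e b"
        using d e unfolding D_def by blast
      have ab: "?L (d + e) (\<lambda>v. a v * b v)"
        by (rule leading_form_mult[OF \<phi> a b])
      then obtain v where v: "v \<in> carrier_vec n" "a v * b v \<noteq> 0"
        unfolding leading_form_def by blast
      have "d + e \<in> D" using ab unfolding D_def by blast
      from \<chi>[OF this g ab v(1)] show ?thesis
        using \<chi>[OF d g a v(1)] \<chi>[OF e g b v(1)] v(2) by simp
    qed
    show "g = \<one>\<^bsub>G\<^esub>" if g: "g \<in> carrier G" and triv: "\<And>d. d \<in> D \<Longrightarrow> \<chi> d g = 1" for g
    proof (rule ccontr)
      assume "g \<noteq> \<one>\<^bsub>G\<^esub>"
      from leading_form_not_fixed[OF cov assms(1,2) g this] obtain d a v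
        where a: "?L d a" and v: "v \<in> carrier_vec n" "a (\<rho> g *\<^sub>v v) \<noteq> a v" by blast
      have "d \<in> D" using a unfolding D_def by blast
      then show False using \<chi>[OF _ g a v(1)] triv v(2) by simp
    qed
  qed
qed

end
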